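(* Let $X$ be a real normed space, let $L\subset X$ be a nontrivial locally compact cone and let $g:X\to\mathbb R$ be $L_g$-Lipschitz continuous, with $L_g>0$. Consider the problem $(P)$: $\inf\{g(x):x\in L\}$. For every $\eta\in(0,1)$, there exist a finite uniform axial deviation outer approximation $D_L^\eta$ of $L$ (at scale $\eta$) and a continuous positively homogeneous function $\Phi_\eta:X\to\mathbb R$ such that $L\subset D_L^\eta=\{\Phi_\eta\ge0\}$ and the following hold. For every $M>L_g$, the penalized problem \[ (P_\eta)\qquad \inf_{x\in X}\bigl\{g(x)+M[-\Phi_\eta(x)]_+\bigr\} \] satisfies $\inf(P_\eta)=\inf_{x\in D_L^\eta}g(x)$, and every solution of $(P_\eta)$ belongs to $D_L^\eta$. If $(P_\eta)$ has a solution $x_\eta$ with $\|x_\eta\|\le R$ for some $R>0$, set $v:=\inf_{x\in L}g(x)$ and $v_\eta:=\min(P_\eta)$. Then $v\in\mathbb R$ and there exists $l_\eta\in L$ such that $\|x_\eta-l_\eta\|\le\eta\|x_\eta\|\le R\eta$. Moreover, \[ 0\le g(l_\eta)-v\le L_g\eta\|x_\eta\|\le L_gR\eta,\qquad 0\le v-v_\eta\le L_g\eta\|x_\eta\|\le L_gR\eta. \] Consequently, $l_\eta$ is an $\varepsilon$-solution of $(P)$, that is, $g(l_\eta)\le v+\varepsilon$, whenever $0<\eta\le\varepsilon/(L_gR)$.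
   Context: $S_X$, $B_X$ are the unit sphere and closed unit ball, $\operatorname{cone}(A)=\{ta:t\ge0,\ a\in A\}$, $t_+=[t]_+=\max\{t,0\}$. A nonempty set $C\subset X$ is a cone if $tC\subset C$ for every $t\ge 0$; all cones are assumed proper, i.e. $\{0_X\}\subsetneq C\subsetneq X$ (not necessarily convex). A cone $L$ is locally compact if for every $x\in L$ there is $r>0$ with $L\cap\{y:\|y-x\|\le r\}$ norm compact. $B_L:=L\cap S_X$, $L_\eta:=\operatorname{cone}(B_L+\eta B_X)$. For $u\in S_X$, $f\in S_{X^*}$ with $f(u)=1$ and $\delta>0$, the uniform axial deviation cone is $C^{\rm ax}(u,f,\delta):=\{x\in X:f(x)-\delta^{-1}\|x-f(x)u\|\ge0\}$. A finite uniform axial deviation outer approximation of $L$ at scale $\eta$ is a closed cone $D_L^\eta=\bigcup_{i=1}^mC_i$ that is a finite union of uniform axial deviation cones $C_i$ with $L\setminus\{0_X\}\subset\bigcup_{i=1}^m\operatorname{int}C_i$ and $L\subset D_L^\eta\subset L_\eta$. A function $g$ is $L_g$-Lipschitz if $|g(x)-g(y)|\le L_g\|x-y\|$ for all $x,y\in X$. A solution of $(P_\eta)$ is a point of $X$ at which the infimum is attained; $\min(P_\eta)$ is then the optimal value. Positively homogeneous: $\Phi(tx)=t\Phi(x)$ for all $t\ge0$. *)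

theory Defs
  imports "HOL-Analysis.Analysis"
begin

(* Cones are not assumed convex. *)
definition proper_cone :: "'a::real_normed_vector set \<Rightarrow> bool" where
  "proper_cone C \<longleftrightarrow> C \<noteq> {} \<and> cone C \<and> {0} \<subset> C \<and> C \<subset> UNIV"

(* Every point of L needs one compact relative ball. This is the literal notion used here,
   not the library predicate "locally compact L". *)
definition locally_compact_cone :: "'a::real_normed_vector set \<Rightarrow> bool" where
  "locally_compact_cone L \<longleftrightarrow>
     proper_cone L \<and> (\<forall>x\<in>L. \<exists>r>0. compact (L \<inter> cball x r))"

definition cone_gen :: "'a::real_normed_vector set \<Rightarrow> 'a set" where
  "cone_gen A = {t *\<^sub>R a | t a. 0 \<le> t \<and> a \<in> A}"

definition cone_base :: "'a::real_normed_vector set \<Rightarrow> 'a set" where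
  "cone_base L = L \<inter> sphere 0 1"

definition cone_enlargement :: "'a::real_normed_vector set \<Rightarrow> real \<Rightarrow> 'a set" where
  "cone_enlargement L \<eta> =
     cone_gen {b + \<eta> *\<^sub>R w | b w. b \<in> cone_base L \<and> w \<in> cball 0 1}"

definition axial_cone :: "'a::real_normed_vector \<Rightarrow> ('a \<Rightarrow>\<^sub>L real) \<Rightarrow> real \<Rightarrow> 'a set" where
  "axial_cone u f \<delta> =
     {x. blinfun_apply f x - inverse \<delta> * norm (x - blinfun_apply f x *\<^sub>R u) \<ge> 0}"

definition uniform_axial_deviation_cone :: "'a::real_normed_vector set \<Rightarrow> bool" where
  "uniform_axial_deviation_cone C \<longleftrightarrow>
     (\<exists>u f \<delta>. norm u = 1 \<and> norm f = 1 \<and> blinfun_apply f u = 1 \<and> 0 < \<delta> \<and>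
        C = axial_cone u f \<delta>)"

definition finite_axial_outer_approx ::
  "'a::real_normed_vector set \<Rightarrow> real \<Rightarrow> 'a set \<Rightarrow> bool" where
  "finite_axial_outer_approx L \<eta> D \<longleftrightarrow>
     closed D \<and> proper_cone D \<and>
     (\<exists>\<C>. finite \<C> \<and> (\<forall>C\<in>\<C>. uniform_axial_deviation_cone C) \<and>
        D = \<Union>\<C> \<and> L - {0} \<subseteq> (\<Union>C\<in>\<C>. interior C)) \<and>
     L \<subseteq> D \<and> D \<subseteq> cone_enlargement L \<eta>"

definition positively_homogeneous :: "('a::real_vector \<Rightarrow> real) \<Rightarrow> bool" where
  "positively_homogeneous \<Phi> \<longleftrightarrow> (\<forall>t\<ge>0. \<forall>x. \<Phi> (t *\<^sub>R x) = t * \<Phi> x)"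

(* Extended-real valued, so that an infimum of minus infinity is represented correctly. *)
definition inf_value :: "'a set \<Rightarrow> ('a \<Rightarrow> real) \<Rightarrow> ereal" where
  "inf_value S h = (INF x\<in>S. ereal (h x))"

definition is_solution :: "'a set \<Rightarrow> ('a \<Rightarrow> real) \<Rightarrow> 'a \<Rightarrow> bool" where
  "is_solution S h x \<longleftrightarrow> x \<in> S \<and> ereal (h x) = inf_value S h"

definition penalized ::
  "('a \<Rightarrow> real) \<Rightarrow> real \<Rightarrow> ('a \<Rightarrow> real) \<Rightarrow> 'a \<Rightarrow> real" where
  "penalized g M \<Phi> x = g x + M * max (- \<Phi> x) 0"

end

theory Submission
  imports Defs
begin

text \<open>
  Local compactness at the origin makes the base of \<open>L\<close> compact.  Each base point \<open>u\<close> has a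
  norming functional \<open>f\<close> (Hahn--Banach), and \<open>u\<close> lies in the interior of the axial cone of
  \<open>(u, f, \<delta>)\<close>; finitely many of these cones cover \<open>L\<close>, and their union is \<open>D\<close>.  A point \<open>x\<close> of such
  a cone is within \<open>\<delta> * f x \<le> \<delta> * norm x\<close> of \<open>f x *\<^sub>R u \<in> L\<close>, which gives both the enlargement
  inclusion and the distance estimate; taking \<open>\<delta>\<close> small enough also keeps a point outside \<open>L\<close> out
  of \<open>D\<close>, so that \<open>D\<close> is proper.  The penalty function is minus the distance to \<open>D\<close>, for which
  exactness holds because \<open>g\<close> cannot decrease faster than its Lipschitz constant.
\<close>

section \<open>Norming functionals\<close>

text \<open>Homogeneity is required only as an inequality, which is what infima of such functions
  deliver directly; equality follows by rescaling with the inverse factor.\<close>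

definition sublinear :: "('a::real_vector \<Rightarrow> real) \<Rightarrow> bool" where
  "sublinear p \<longleftrightarrow> (\<forall>x y. p (x + y) \<le> p x + p y) \<and> (\<forall>c\<ge>0. \<forall>x. p (c *\<^sub>R x) \<le> c * p x)"

lemma sublinear_add: "sublinear p \<Longrightarrow> p (x + y) \<le> p x + p y"
  and sublinear_scale_le: "sublinear p \<Longrightarrow> 0 \<le> c \<Longrightarrow> p (c *\<^sub>R x) \<le> c * p x"
  by (auto simp: sublinear_def)

lemma sublinear_zero: "sublinear p \<Longrightarrow> p 0 = 0"
  using sublinear_add[of p 0 0] sublinear_scale_le[of p 0 0] by simp

lemma sublinear_scale:
  assumes "sublinear p" "0 \<le> c"
  shows "p (c *\<^sub>R x) = c * p x"
proof (cases "c = 0")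
  case True
  then show ?thesis using sublinear_zero[OF assms(1)] by simp
next
  case False
  with assms have "p (inverse c *\<^sub>R (c *\<^sub>R x)) \<le> inverse c * p (c *\<^sub>R x)"
    by (intro sublinear_scale_le) auto
  with False assms have "c * p x \<le> p (c *\<^sub>R x)"
    by (simp add: field_simps)
  then show ?thesis
    using sublinear_scale_le[OF assms, of x] by simp
qed

lemma sublinear_ge: "sublinear p \<Longrightarrow> - p (- x) \<le> p x"
  using sublinear_add[of p x "- x"] sublinear_zero[of p] by simp

lemma sublinear_norm: "sublinear norm"
  by (auto simp: sublinear_def norm_triangle_ineq)

text \<open>The Hahn-Banach lowering step: \<open>q x\<close> is the infimum of
  \<open>p (x + t *\<^sub>R y) - t * p y\<close> over \<open>t \<ge> 0\<close>. The choice
  \<open>t = 0\<close> gives \<open>q \<le> p\<close>, and \<open>t = 1\<close> gives the last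
  bound, which forces \<open>q (- y) \<le> - p y\<close>.\<close>

lemma sublinear_lower_at:
  fixes p :: "'a::real_vector \<Rightarrow> real"
  assumes p: "sublinear p"
  obtains q where "sublinear q" "q \<le> p" "\<And>x. q x \<le> p (x + y) - p y"
proof -
  define h where "h x t = p (x + t *\<^sub>R y) - t * p y" for x t
  define q where "q x = (INF t\<in>{0..}. h x t)" for x
  have bdd: "bdd_below (h x ` {0..})" for x
  proof (intro bdd_belowI2)
    fix t :: real assume "t \<in> {0..}"
    then have "t * p y = p (t *\<^sub>R y)" using sublinear_scale[OF p] by simp
    also have "\<dots> \<le> p (x + t *\<^sub>R y) + p (- x)"
      using sublinear_add[OF p, of "x + t *\<^sub>R y" "- x"] by simp
    finally show "- p (- x) \<le> h x t" by (simp add: h_def)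
  qed
  have q_le: "q x \<le> h x t" if "0 \<le> t" for x t
    unfolding q_def using bdd that by (intro cINF_lower) auto
  have le_q: "c \<le> q x" if "\<And>t. 0 \<le> t \<Longrightarrow> c \<le> h x t" for x c
    unfolding q_def using that by (intro cINF_greatest) auto
  \<comment> \<open>The parameters chosen for \<open>x\<close> and \<open>z\<close> add up. The two
    infima are then taken one after the other, with the remaining term moved to the left
    side.\<close>
  have add: "q (x + z) \<le> q x + q z" for x z
  proof -
    have "q (x + z) - h x s \<le> h z t" if "0 \<le> s" "0 \<le> t" for s t
    proof -
      have "q (x + z) \<le> h (x + z) (s + t)" using that by (intro q_le) auto
      also have "\<dots> \<le> h x s + h z t"
        using sublinear_add[OF p, of "x + s *\<^sub>R y" "z + t *\<^sub>R y"]
        by (simp add: h_def algebra_simps)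
      finally show ?thesis by simp
    qed
    then have "q (x + z) - h x s \<le> q z" if "0 \<le> s" for s
      using that by (intro le_q)
    then have "q (x + z) - q z \<le> q x"
      by (intro le_q) (simp add: algebra_simps)
    then show ?thesis by simp
  qed
  have scale: "q (c *\<^sub>R x) \<le> c * q x" if "0 \<le> c" for c x
  proof (cases "c = 0")
    case True
    then show ?thesis using q_le[of 0 0] sublinear_zero[OF p] by (simp add: h_def)
  next
    case False
    with that have c: "0 < c" by simp
    have "q (c *\<^sub>R x) / c \<le> h x t" if "0 \<le> t" for t
    proof -
      \<comment> \<open>The parameter is stretched together with the point, so that \<open>c\<close>
        factors out of \<open>h\<close>.\<close>
      have "q (c *\<^sub>R x) \<le> h (c *\<^sub>R x) (c * t)" using c that by (intro q_le) auto
      also have "\<dots> = c * h x t"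
        using sublinear_scale[OF p, of c "x + t *\<^sub>R y"] c
        by (simp add: h_def algebra_simps)
      finally show ?thesis using c by (simp add: field_simps)
    qed
    then have "q (c *\<^sub>R x) / c \<le> q x" by (rule le_q)
    then show ?thesis using c by (simp add: field_simps)
  qed
  show thesis
  proof
    show "sublinear q" using add scale by (auto simp: sublinear_def)
    show "q \<le> p" using q_le[of 0] by (auto simp: le_fun_def h_def)
    show "q x \<le> p (x + y) - p y" for x using q_le[of 1 x] by (simp add: h_def)
  qed
qed

text \<open>The witness is the pointwise infimum, finite because every member satisfies
  \<open>- q (- x) \<le> p x\<close>. The chain condition serves subadditivity: two members are
  replaced by the smaller one before evaluation at \<open>x + y\<close>.\<close>

lemma sublinear_INF_chain:
  fixes C :: "('a::real_vector \<Rightarrow> real) set"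
  assumes "C \<noteq> {}" and sub: "\<And>p. p \<in> C \<Longrightarrow> sublinear p" and le: "\<And>p. p \<in> C \<Longrightarrow> p \<le> q"
    and chain: "\<And>p p'. p \<in> C \<Longrightarrow> p' \<in> C \<Longrightarrow> p \<le> p' \<or> p' \<le> p"
  obtains r where "sublinear r" "\<And>p. p \<in> C \<Longrightarrow> r \<le> p"
proof -
  define r where "r x = (INF p\<in>C. p x)" for x
  have bdd: "bdd_below ((\<lambda>p. p x) ` C)" for x
  proof (intro bdd_belowI2)
    fix p assume "p \<in> C"
    then show "- q (- x) \<le> p x"
      using sublinear_ge[OF sub, of p x] le[of p] by (auto simp: le_fun_def intro: order_trans[rotated])
  qed
  have r_le: "r x \<le> p x" if "p \<in> C" for p x
    unfolding r_def using bdd that by (intro cINF_lower)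
  have le_r: "c \<le> r x" if "\<And>p. p \<in> C \<Longrightarrow> c \<le> p x" for x c
    unfolding r_def using that \<open>C \<noteq> {}\<close> by (intro cINF_greatest)
  have add: "r (x + y) \<le> r x + r y" for x y
  proof -
    have "r (x + y) - p x \<le> p' y" if "p \<in> C" "p' \<in> C" for p p'
    proof -
      obtain s where s: "s \<in> C" "s \<le> p" "s \<le> p'"
        using chain[OF \<open>p \<in> C\<close> \<open>p' \<in> C\<close>] \<open>p \<in> C\<close> \<open>p' \<in> C\<close> by blast
      have "r (x + y) \<le> s (x + y)" by (rule r_le[OF s(1)])
      also have "\<dots> \<le> s x + s y" by (rule sublinear_add[OF sub[OF s(1)]])
      also have "\<dots> \<le> p x + p' y" using s by (intro add_mono) (auto simp: le_fun_def)
      finally show ?thesis by simp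
    qed
    then have "r (x + y) - p x \<le> r y" if "p \<in> C" for p
      using that by (intro le_r)
    then have "r (x + y) - r y \<le> r x"
      by (intro le_r) (simp add: algebra_simps)
    then show ?thesis by simp
  qed
  have scale: "r (c *\<^sub>R x) \<le> c * r x" if "0 \<le> c" for c x
  proof (cases "c = 0")
    case True
    obtain p where "p \<in> C" using \<open>C \<noteq> {}\<close> by blast
    then show ?thesis using True r_le[of p 0] sublinear_zero[OF sub, of p] by simp
  next
    case False
    with that have c: "0 < c" by simp
    have "r (c *\<^sub>R x) / c \<le> p x" if "p \<in> C" for p
      using r_le[OF that, of "c *\<^sub>R x"] sublinear_scale[OF sub[OF that], of c x] c
      by (simp add: field_simps)
    then have "r (c *\<^sub>R x) / c \<le> r x" by (rule le_r)
    then show ?thesis using c by (simp add: field_simps)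
  qed
  show thesis
    using add scale r_le by (intro that[of r]) (auto simp: sublinear_def le_fun_def)
qed

lemma minimal_sublinear_exists:
  assumes q: "sublinear q"
  obtains p where "sublinear p" "p \<le> q" "\<And>p'. sublinear p' \<Longrightarrow> p' \<le> p \<Longrightarrow> p' = p"
proof -
  define A where "A = {p. sublinear p \<and> p \<le> q}"
  \<comment> \<open>Zorn's lemma is applied to the reversed order: maximal elements are minimal
    functions, and chains need pointwise lower bounds.\<close>
  have "\<exists>m\<in>A. \<forall>a\<in>A. m \<ge> a \<longrightarrow> a = m"
  proof (rule predicate_Zorn)
    show "partial_order_on A (relation_of (\<ge>) A)"
      by (rule partial_order_on_relation_ofI) auto
  next
    fix C assume C: "C \<in> Chains (relation_of (\<ge>) A)"
    show "\<exists>u\<in>A. \<forall>a\<in>C. a \<ge> u"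
    proof (cases "C = {}")
      case True
      then show ?thesis using q by (auto simp: A_def)
    next
      case False
      have CA: "C \<subseteq> A" using C by (auto simp: Chains_def relation_of_def)
      have sub: "sublinear p" "p \<le> q" if "p \<in> C" for p
        using that CA by (auto simp: A_def)
      have chain: "p \<le> p' \<or> p' \<le> p" if "p \<in> C" "p' \<in> C" for p p'
        using that C by (auto simp: Chains_def relation_of_def)
      obtain r where r: "sublinear r" "\<And>p. p \<in> C \<Longrightarrow> r \<le> p"
        using sublinear_INF_chain[OF False sub chain] by blast
      obtain p where "p \<in> C" using False by blast
      then have "r \<le> q" using order_trans[OF r(2) sub(2)] by blast
      then show ?thesis using r by (auto simp: A_def)
    qed
  qed
  then obtain m where m: "m \<in> A" "\<And>a. a \<in> A \<Longrightarrow> a \<le> m \<Longrightarrow> a = m" by blast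
  show thesis
  proof (rule that)
    show "sublinear m" "m \<le> q" using m(1) by (auto simp: A_def)
    show "p' = m" if "sublinear p'" "p' \<le> m" for p'
      using that m by (auto simp: A_def intro: order_trans)
  qed
qed

text \<open>Minimality forces linearity: a minimal \<open>p\<close> equals its lowering in every direction \<open>y\<close>, which
  is the inequality missing from subadditivity.\<close>

lemma sublinear_dominates_linear:
  assumes q: "sublinear q"
  obtains f where "linear f" "f \<le> q"
proof -
  obtain p where p: "sublinear p" "p \<le> q" "\<And>p'. sublinear p' \<Longrightarrow> p' \<le> p \<Longrightarrow> p' = p"
    using minimal_sublinear_exists[OF q] by blast
  have add: "p (x + y) = p x + p y" for x y
  proof -
    obtain r where "sublinear r" "r \<le> p" "\<And>x. r x \<le> p (x + y) - p y"
      using sublinear_lower_at[OF p(1), of y] by blast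
    with p(3)[of r] have "p x \<le> p (x + y) - p y" by auto
    then show ?thesis using sublinear_add[OF p(1), of x y] by simp
  qed
  have neg: "p (- x) = - p x" for x
    using add[of x "- x"] sublinear_zero[OF p(1)] by simp
  have "p (c *\<^sub>R x) = c *\<^sub>R p x" for c x
  proof (cases "0 \<le> c")
    case True
    then show ?thesis using sublinear_scale[OF p(1)] by simp
  next
    case False
    then show ?thesis using sublinear_scale[OF p(1), of "- c" x] neg[of "c *\<^sub>R x"] by simp
  qed
  with add have "linear p" by (intro linearI)
  with p(2) show thesis by (rule that[rotated -1])
qed

text \<open>The norm is lowered in the direction \<open>u\<close> before a linear minorant
  \<open>h\<close> is taken. This yields \<open>h (- u) \<le> -1\<close>, while
  \<open>h \<le> norm\<close> bounds \<open>h u\<close> by 1 from above.\<close>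

lemma norming_functional_exists:
  fixes u :: "'a::real_normed_vector"
  assumes "norm u = 1"
  obtains f :: "'a \<Rightarrow>\<^sub>L real" where "norm f = 1" "blinfun_apply f u = 1"
proof -
  obtain q where q: "sublinear q" "q \<le> norm" "\<And>x. q x \<le> norm (x + u) - norm u"
    using sublinear_lower_at[OF sublinear_norm, of u] by blast
  obtain h where h: "linear h" "h \<le> q"
    using sublinear_dominates_linear[OF q(1)] by blast
  have h_le: "h x \<le> norm x" for x
    using h(2) q(2) by (meson le_funD order_trans)
  have h_abs: "norm (h x) \<le> norm x" for x
    using h_le[of x] h_le[of "- x"] linear_neg[OF h(1), of x] by (simp add: abs_le_iff)
  have "h (- u) \<le> -1"
    using h(2) q(3)[of "- u"] assms by (force simp: le_fun_def intro: order_trans)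
  with h_le[of u] assms have hu: "h u = 1"
    using linear_neg[OF h(1), of u] by simp
  have bl: "bounded_linear h"
    using h_abs by (intro bounded_linear_intro[of h 1])
      (auto simp: linear_add[OF h(1)] linear_scale[OF h(1)])
  define f where "f = Blinfun h"
  have f: "blinfun_apply f = h"
    unfolding f_def using bl by (rule bounded_linear_Blinfun_apply)
  have "norm f \<le> 1"
    using h_abs f by (intro norm_blinfun_bound) auto
  moreover have "1 \<le> norm f"
    using norm_blinfun[of f u] f hu assms by simp
  ultimately show thesis using hu f by (intro that[of f]) auto
qed

section \<open>Axial cones\<close>

lemma axial_cone_scale:
  assumes "x \<in> axial_cone u f \<delta>" "0 \<le> t"
  shows "t *\<^sub>R x \<in> axial_cone u f \<delta>"
proof -
  have "t *\<^sub>R x - (t * f x) *\<^sub>R u = t *\<^sub>R (x - f x *\<^sub>R u)"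
    by (simp add: scaleR_diff_right)
  then have "f (t *\<^sub>R x) - inverse \<delta> * norm (t *\<^sub>R x - f (t *\<^sub>R x) *\<^sub>R u) =
      t * (f x - inverse \<delta> * norm (x - f x *\<^sub>R u))"
    using assms(2) by (simp add: blinfun.scaleR_right right_diff_distrib mult.left_commute)
  moreover have "0 \<le> t * (f x - inverse \<delta> * norm (x - f x *\<^sub>R u))"
    using assms by (simp add: axial_cone_def)
  ultimately show ?thesis by (simp add: axial_cone_def)
qed

lemma closed_axial_cone: "closed (axial_cone u f \<delta>)"
  unfolding axial_cone_def by (intro closed_Collect_le continuous_intros)

text \<open>The strict version of the defining inequality cuts out an open set. At
  \<open>t *\<^sub>R u\<close> the deviation term vanishes and the value \<open>t > 0\<close>
  remains.\<close>

lemma scaleR_axis_in_interior_axial_cone: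
  assumes "blinfun_apply f u = 1" "0 < t"
  shows "t *\<^sub>R u \<in> interior (axial_cone u f \<delta>)"
proof (rule interiorI)
  let ?S = "{x. 0 < f x - inverse \<delta> * norm (x - f x *\<^sub>R u)}"
  show "open ?S" by (intro open_Collect_less continuous_intros)
  show "t *\<^sub>R u \<in> ?S" using assms by (simp add: blinfun.scaleR_right)
  show "?S \<subseteq> axial_cone u f \<delta>" by (auto simp: axial_cone_def)
qed

text \<open>Dilation by \<open>t > 0\<close> is an open map that sends the cone into itself; this
  later carries the covering of the base over to all nonzero points of the cone.\<close>

lemma interior_axial_cone_scale:
  assumes "x \<in> interior (axial_cone u f \<delta>)" "0 < t"
  shows "t *\<^sub>R x \<in> interior (axial_cone u f \<delta>)"
proof -
  have "t *\<^sub>R x \<in> (*\<^sub>R) t ` interior (axial_cone u f \<delta>)" using assms by blast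
  moreover have "open ((*\<^sub>R) t ` interior (axial_cone u f \<delta>))"
    using assms by (intro open_scaling) auto
  moreover have "(*\<^sub>R) t ` interior (axial_cone u f \<delta>) \<subseteq> axial_cone u f \<delta>"
    using interior_subset assms by (blast intro: axial_cone_scale less_imp_le)
  ultimately show ?thesis by (meson interiorI)
qed

lemma axial_cone_near_axis:
  assumes "x \<in> axial_cone u f \<delta>" "norm f = 1" "0 < \<delta>"
  shows "0 \<le> f x" "f x \<le> norm x" "norm (x - f x *\<^sub>R u) \<le> \<delta> * f x"
proof -
  have "inverse \<delta> * norm (x - f x *\<^sub>R u) \<le> f x"
    using assms(1) by (simp add: axial_cone_def)
  then show *: "norm (x - f x *\<^sub>R u) \<le> \<delta> * f x"
    using assms(3) by (simp add: field_simps)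
  then have "0 \<le> \<delta> * f x" using norm_ge_zero order_trans by blast
  then show "0 \<le> f x" using assms(3) by (simp add: zero_le_mult_iff)
  show "f x \<le> norm x" using norm_blinfun[of f x] assms(2) by simp
qed

section \<open>Outer approximations of locally compact cones\<close>

text \<open>Only the compact ball at the origin is used: its intersection with the sphere of the
  same radius \<open>r\<close> is compact, and dilation by \<open>inverse r\<close> maps it onto the
  base.\<close>

lemma compact_cone_base:
  fixes L :: "'a::real_normed_vector set"
  assumes "locally_compact_cone L"
  shows "compact (cone_base L)"
proof -
  have L: "cone L" "0 \<in> L"
    using assms by (auto simp: locally_compact_cone_def proper_cone_def)
  then obtain r where r: "0 < r" "compact (L \<inter> cball 0 r)"
    using assms by (auto simp: locally_compact_cone_def)
  have "closed (sphere (0::'a) r)"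
    unfolding sphere_def dist_norm by (intro closed_Collect_eq continuous_intros)
  with r have "compact ((*\<^sub>R) (inverse r) ` (L \<inter> cball 0 r \<inter> sphere 0 r))"
    by (intro compact_scaling compact_Int_closed[of "L \<inter> cball 0 r"])
  also have "(*\<^sub>R) (inverse r) ` (L \<inter> cball 0 r \<inter> sphere 0 r) = cone_base L"
  proof (intro equalityI subsetI)
    fix x assume "x \<in> (*\<^sub>R) (inverse r) ` (L \<inter> cball 0 r \<inter> sphere 0 r)"
    then show "x \<in> cone_base L"
      using r L by (auto simp: cone_base_def mem_cone)
  next
    fix x assume "x \<in> cone_base L"
    then have "r *\<^sub>R x \<in> L \<inter> cball 0 r \<inter> sphere 0 r" "x = inverse r *\<^sub>R (r *\<^sub>R x)"
      using r L by (auto simp: cone_base_def mem_cone)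
    then show "x \<in> (*\<^sub>R) (inverse r) ` (L \<inter> cball 0 r \<inter> sphere 0 r)" by blast
  qed
  finally show ?thesis .
qed

text \<open>This supplies the point that a sufficiently thin outer approximation misses. Axis points
  close to \<open>z\<close> have norm at most \<open>norm z\<close>, so only a compact piece of
  \<open>L\<close> has to be kept away from \<open>z\<close>.\<close>

lemma locally_compact_cone_gap:
  assumes "locally_compact_cone L"
  obtains z \<delta> where "0 < \<delta>" "\<And>l. l \<in> L \<Longrightarrow> norm l \<le> norm z \<Longrightarrow> \<delta> * norm z < norm (z - l)"
proof -
  have L: "cone L" "0 \<in> L" "L \<noteq> UNIV"
    using assms by (auto simp: locally_compact_cone_def proper_cone_def)
  then obtain r where r: "0 < r" "compact (L \<inter> cball 0 r)"
    using assms by (auto simp: locally_compact_cone_def)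
  obtain y where y: "y \<notin> L" using L by blast
  with L have y0: "y \<noteq> 0" by auto
  \<comment> \<open>A point outside \<open>L\<close> is moved to radius \<open>r\<close>, so that
    \<open>norm l \<le> norm z\<close> means membership in the compact piece.\<close>
  define z where "z = (r / norm y) *\<^sub>R y"
  have nz: "norm z = r" using y0 r by (simp add: z_def)
  have "z \<notin> L"
  proof
    assume "z \<in> L"
    then have "(norm y / r) *\<^sub>R z \<in> L" using L r by (intro mem_cone) auto
    then show False using y y0 r by (simp add: z_def)
  qed
  let ?K = "L \<inter> cball 0 r"
  have K: "closed ?K" "?K \<noteq> {}" "z \<notin> ?K"
    using r L \<open>z \<notin> L\<close> compact_imp_closed by auto
  then have pos: "0 < infdist z ?K"
    using in_closed_iff_infdist_zero[of ?K z] infdist_nonneg[of z ?K] by (metis less_le)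
  show thesis
  proof (rule that)
    \<comment> \<open>Division by \<open>r = norm z\<close> makes the gap relative; the factor 2
      makes it strict.\<close>
    show "0 < infdist z ?K / (2 * r)" using pos r by simp
    fix l assume "l \<in> L" "norm l \<le> norm z"
    then have "infdist z ?K \<le> norm (z - l)"
      using nz infdist_le[of l ?K z] by (simp add: dist_norm)
    then show "infdist z ?K / (2 * r) * norm z < norm (z - l)"
      using pos nz r by simp
  qed
qed

text \<open>The distance estimate is a separate conclusion because membership in the enlargement
  only bounds the error by \<open>\<eta> * t\<close>, with a factor \<open>t\<close> that may exceed
  \<open>norm x\<close>. Here the factor is \<open>f x\<close>, which is at most
  \<open>norm x\<close>.\<close>

lemma finite_axial_outer_approx_exists:
  fixes L :: "'a::real_normed_vector set"
  assumes lc: "locally_compact_cone L" and \<eta>: "0 < \<eta>"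
  obtains D where "finite_axial_outer_approx L \<eta> D"
    "\<And>x. x \<in> D \<Longrightarrow> \<exists>l\<in>L. norm (x - l) \<le> \<eta> * norm x"
proof -
  have L: "cone L" "0 \<in> L" "\<exists>x\<in>L. x \<noteq> 0"
    using lc by (auto simp: locally_compact_cone_def proper_cone_def)
  obtain z \<delta>' where z: "0 < \<delta>'"
    "\<And>l. l \<in> L \<Longrightarrow> norm l \<le> norm z \<Longrightarrow> \<delta>' * norm z < norm (z - l)"
    using locally_compact_cone_gap[OF lc] by blast
  \<comment> \<open>The bound \<open>\<eta>\<close> serves the enlargement and the distance
    estimate; the bound \<open>\<delta>'\<close> keeps \<open>z\<close> outside
    \<open>D\<close>.\<close>
  define \<delta> where "\<delta> = min \<delta>' \<eta>"
  have \<delta>: "0 < \<delta>" "\<delta> \<le> \<eta>" "\<delta> \<le> \<delta>'" using z \<eta> by (auto simp: \<delta>_def)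
  have "\<exists>f :: 'a \<Rightarrow>\<^sub>L real. norm f = 1 \<and> blinfun_apply f u = 1" if "u \<in> cone_base L" for u
    using norming_functional_exists[of u] that by (auto simp: cone_base_def)
  then obtain F :: "'a \<Rightarrow> 'a \<Rightarrow>\<^sub>L real" where
    F: "\<And>u. u \<in> cone_base L \<Longrightarrow> norm (F u) = 1" "\<And>u. u \<in> cone_base L \<Longrightarrow> F u u = 1"
    by metis
  define A where "A u = axial_cone u (F u) \<delta>" for u
  have "cone_base L \<subseteq> (\<Union>u\<in>cone_base L. interior (A u))"
    using scaleR_axis_in_interior_axial_cone[of "F _" _ 1] F by (fastforce simp: A_def)
  then obtain T where T: "T \<subseteq> cone_base L" "finite T" "cone_base L \<subseteq> (\<Union>u\<in>T. interior (A u))"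
    using compactE_image[OF compact_cone_base[OF lc], of "cone_base L" "\<lambda>u. interior (A u)"]
    by auto
  define D where "D = (\<Union>u\<in>T. A u)"
  have near: "\<exists>u\<in>T. 0 \<le> F u x \<and> F u x \<le> norm x \<and> norm (x - F u x *\<^sub>R u) \<le> \<delta> * F u x"
    if "x \<in> D" for x
    using that T(1) F(1) \<delta>(1) axial_cone_near_axis unfolding D_def A_def by blast
  have axis: "t *\<^sub>R u \<in> L" "norm (t *\<^sub>R u) = t" if "u \<in> T" "0 \<le> t" for u t
    using that T(1) L(1) by (auto simp: cone_base_def mem_cone)
  have L_int: "L - {0} \<subseteq> (\<Union>C\<in>A ` T. interior C)"
  proof
    fix x assume x: "x \<in> L - {0}"
    then have "inverse (norm x) *\<^sub>R x \<in> cone_base L"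
      using L(1) by (auto simp: cone_base_def mem_cone)
    then obtain u where u: "u \<in> T" "inverse (norm x) *\<^sub>R x \<in> interior (A u)"
      using T(3) by blast
    have "norm x *\<^sub>R (inverse (norm x) *\<^sub>R x) \<in> interior (A u)"
      using interior_axial_cone_scale[OF u(2)[unfolded A_def], of "norm x"] x
      unfolding A_def by simp
    with u x show "x \<in> (\<Union>C\<in>A ` T. interior C)" by auto
  qed
  have zero: "0 \<in> D"
  proof -
    \<comment> \<open>Every axial cone contains 0, so it suffices that the finite family is
      nonempty, which the nontriviality of \<open>L\<close> guarantees.\<close>
    obtain x where "x \<in> L - {0}" using L(3) by blast
    then have "T \<noteq> {}" using L_int by auto
    then show ?thesis by (auto simp: D_def A_def axial_cone_def)
  qed
  have "L - {0} \<subseteq> D"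
    using L_int interior_subset by (fastforce simp: D_def)
  with zero have LD: "L \<subseteq> D" by auto
  have encl: "D \<subseteq> cone_enlargement L \<eta>"
  proof
    fix x assume "x \<in> D"
    then obtain u where u: "u \<in> T" "0 \<le> F u x" "norm (x - F u x *\<^sub>R u) \<le> \<delta> * F u x"
      using near by blast
    define t where "t = F u x"
    \<comment> \<open>The deviation from the axis is normalized by \<open>\<eta> * t\<close>. For
      \<open>t = 0\<close> the inverse is 0, hence \<open>w = 0\<close>, and the bound
      \<open>d\<close> below forces \<open>x = 0\<close>.\<close>
    define w where "w = (inverse (\<eta> * t)) *\<^sub>R (x - t *\<^sub>R u)"
    have d: "norm (x - t *\<^sub>R u) \<le> \<eta> * t"
      using u \<delta>(2) mult_right_mono[of \<delta> \<eta> t] by (simp add: t_def)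
    have "x = t *\<^sub>R (u + \<eta> *\<^sub>R w)"
    proof (cases "t = 0")
      case True
      then show ?thesis using d by simp
    next
      case False
      then have "t * (\<eta> * inverse (\<eta> * t)) = 1" using \<eta> by (simp add: field_simps)
      then show ?thesis by (simp only: w_def scaleR_add_right scaleR_scaleR) simp
    qed
    moreover have "norm w \<le> 1"
    proof (cases "t = 0")
      case True
      then show ?thesis by (simp add: w_def)
    next
      case False
      then have "0 < \<eta> * t" using u \<eta> by (simp add: t_def)
      with d have "inverse (\<eta> * t) * norm (x - t *\<^sub>R u) \<le> 1"
        by (simp add: field_simps)
      moreover have "norm w = inverse (\<eta> * t) * norm (x - t *\<^sub>R u)"
        using u(2) \<eta> by (simp add: w_def t_def abs_mult)
      ultimately show ?thesis by simp
    qed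
    moreover have "u \<in> cone_base L" "0 \<le> t" using u T(1) by (auto simp: t_def)
    ultimately show "x \<in> cone_enlargement L \<eta>"
      unfolding cone_enlargement_def cone_gen_def mem_Collect_eq mem_cball_0 by blast
  qed
  have "z \<notin> D"
  proof
    assume "z \<in> D"
    then obtain u where u: "u \<in> T" "0 \<le> F u z" "F u z \<le> norm z"
      "norm (z - F u z *\<^sub>R u) \<le> \<delta> * F u z"
      using near by blast
    \<comment> \<open>The axis point \<open>F u z *\<^sub>R u\<close> lies in \<open>L\<close> with
      norm \<open>F u z\<close>, hence it is subject to the gap at \<open>z\<close>.\<close>
    have "\<delta> * F u z \<le> \<delta>' * norm z" using u \<delta> by (intro mult_mono) auto
    moreover have "\<delta>' * norm z < norm (z - F u z *\<^sub>R u)"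
      by (rule z(2)) (use axis[OF u(1,2)] u(3) in simp_all)
    ultimately show False using u(4) by simp
  qed
  moreover have "cone D"
    unfolding cone_def D_def A_def by (auto intro: axial_cone_scale)
  ultimately have "proper_cone D"
    using zero LD L(3) unfolding proper_cone_def by blast
  moreover have "closed D"
    unfolding D_def A_def using T(2) by (intro closed_UN ballI closed_axial_cone)
  moreover have "uniform_axial_deviation_cone C" if "C \<in> A ` T" for C
    using that T(1) F \<delta>(1) unfolding uniform_axial_deviation_cone_def A_def cone_base_def
    by fastforce
  ultimately have "finite_axial_outer_approx L \<eta> D"
    unfolding finite_axial_outer_approx_def using T(2) L_int LD encl
    by (auto simp: D_def intro!: exI[of _ "A ` T"])
  moreover have "\<exists>l\<in>L. norm (x - l) \<le> \<eta> * norm x" if "x \<in> D" for x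
  proof -
    obtain u where u: "u \<in> T" "0 \<le> F u x" "F u x \<le> norm x"
      "norm (x - F u x *\<^sub>R u) \<le> \<delta> * F u x"
      using near[OF \<open>x \<in> D\<close>] by blast
    have "\<delta> * F u x \<le> \<eta> * norm x" using u \<delta> by (intro mult_mono) auto
    with u axis show ?thesis by (meson order_trans)
  qed
  ultimately show thesis by (rule that)
qed

section \<open>Exact penalization by the distance\<close>

text \<open>Scaling the competitors in \<open>D\<close> gives one inequality for each positive
  factor; applying it with \<open>t\<close> and with \<open>inverse t\<close> gives
  equality.\<close>

lemma infdist_cone_scale:
  fixes D :: "'a::real_normed_vector set"
  assumes "cone D" "0 \<in> D" "0 \<le> t"
  shows "infdist (t *\<^sub>R x) D = t * infdist x D"
proof (cases "t = 0")
  case True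
  then show ?thesis using assms by simp
next
  case False
  have le: "infdist (s *\<^sub>R y) D \<le> s * infdist y D" if "0 < s" for s y
  proof -
    have "infdist (s *\<^sub>R y) D / s \<le> dist y d" if "d \<in> D" for d
    proof -
      have "infdist (s *\<^sub>R y) D \<le> dist (s *\<^sub>R y) (s *\<^sub>R d)"
        using that assms \<open>0 < s\<close> by (intro infdist_le mem_cone) auto
      also have "\<dots> = s * dist y d"
        using \<open>0 < s\<close> by (simp add: dist_norm flip: scaleR_diff_right)
      finally show ?thesis using \<open>0 < s\<close> by (simp add: field_simps)
    qed
    then have "infdist (s *\<^sub>R y) D / s \<le> infdist y D"
      using assms by (subst (2) infdist_notempty) (auto intro!: cINF_greatest)
    then show ?thesis using \<open>0 < s\<close> by (simp add: field_simps)
  qed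
  show ?thesis
    using le[of t x] le[of "inverse t" "t *\<^sub>R x"] False assms(3)
    by (simp add: field_simps)
qed

text \<open>Neither the infimum nor the distance need be attained. A real \<open>r\<close> strictly
  between the two sides would lie below \<open>g\<close> on \<open>D\<close>, so every point of
  \<open>D\<close> would be at distance at least \<open>(r - g x) / K\<close> from \<open>x\<close>,
  which contradicts the choice of \<open>r\<close>.\<close>

lemma inf_value_le_lipschitz_infdist:
  assumes "K-lipschitz_on UNIV g" "0 < K" "D \<noteq> {}"
  shows "inf_value D g \<le> ereal (g x + K * infdist x D)"
proof (rule ccontr)
  assume "\<not> ?thesis"
  then obtain r where r: "ereal (g x + K * infdist x D) < ereal r" "ereal r < inf_value D g"
    using ereal_dense2 by (metis not_le)
  have "(r - g x) / K \<le> dist x y" if "y \<in> D" for y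
  proof -
    have "inf_value D g \<le> ereal (g y)"
      unfolding inf_value_def using that by (rule INF_lower)
    with r(2) have "ereal r < ereal (g y)" by (rule less_le_trans)
    then have "r < g y" by simp
    moreover have "g y \<le> g x + K * dist x y"
      using lipschitz_onD[OF assms(1), of x y] by (simp add: dist_real_def)
    ultimately show ?thesis using assms(2) by (simp add: field_simps)
  qed
  then have "(r - g x) / K \<le> infdist x D"
    using assms(3) by (subst infdist_notempty) (auto intro!: cINF_greatest)
  then show False using r(1) assms(2) by (simp add: field_simps)
qed

lemma penalized_infdist:
  "penalized g M (\<lambda>x. - infdist x D) x = g x + M * infdist x D"
  by (simp add: penalized_def infdist_nonneg max_absorb1)

text \<open>The penalty vanishes on \<open>D\<close>, which gives one inequality; the Lipschitz
  bound with \<open>K\<close> enlarged to \<open>M\<close> gives the other.\<close>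

lemma inf_value_penalized_infdist:
  assumes "K-lipschitz_on UNIV g" "0 < K" "D \<noteq> {}" "K \<le> M"
  shows "inf_value UNIV (penalized g M (\<lambda>x. - infdist x D)) = inf_value D g"
proof (rule antisym)
  show "inf_value UNIV (penalized g M (\<lambda>x. - infdist x D)) \<le> inf_value D g"
    unfolding inf_value_def penalized_infdist
  proof (rule INF_mono)
    fix y assume "y \<in> D"
    then show "\<exists>x\<in>UNIV. ereal (g x + M * infdist x D) \<le> ereal (g y)"
      by (intro bexI[of _ y]) auto
  qed
next
  have "inf_value D g \<le> ereal (g x + M * infdist x D)" for x
    using inf_value_le_lipschitz_infdist[OF assms(1-3), of x]
      mult_right_mono[OF assms(4) infdist_nonneg[of x D]]
    by (meson add_left_mono ereal_less_eq(3) order_trans)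
  then show "inf_value D g \<le> inf_value UNIV (penalized g M (\<lambda>x. - infdist x D))"
    by (subst (2) inf_value_def) (auto simp: penalized_infdist intro: INF_greatest)
qed

text \<open>Outside the closed set \<open>D\<close> the distance is positive, so
  \<open>K < M\<close> makes the penalized value exceed the Lipschitz bound strictly, and hence also
  the infimum over \<open>D\<close>.\<close>

lemma penalized_infdist_solution_mem:
  assumes "K-lipschitz_on UNIV g" "0 < K" "closed D" "D \<noteq> {}" "K < M"
    and sol: "is_solution UNIV (penalized g M (\<lambda>x. - infdist x D)) x"
  shows "x \<in> D"
proof (rule ccontr)
  assume "x \<notin> D"
  then have "0 < infdist x D"
    using assms(3,4) in_closed_iff_infdist_zero[of D x] infdist_nonneg[of x D]
    by (simp add: less_le)
  then have "g x + K * infdist x D < g x + M * infdist x D"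
    using assms(5) by simp
  moreover have "ereal (g x + M * infdist x D) = inf_value D g"
    using sol inf_value_penalized_infdist[OF assms(1,2,4), of M] assms(5)
    by (simp add: is_solution_def penalized_infdist)
  ultimately show False
    using inf_value_le_lipschitz_infdist[OF assms(1,2,4), of x] by (metis ereal_less_eq(3) not_le)
qed

section \<open>Distance penalty for the axial outer approximation, with error estimates\<close>

theorem theorem5p8:
  fixes L :: "'a::real_normed_vector set" and g :: "'a \<Rightarrow> real" and L\<^sub>g :: real
  assumes "locally_compact_cone L"
    and "0 < L\<^sub>g"
    and "L\<^sub>g-lipschitz_on UNIV g"
  shows "\<forall>\<eta>. 0 < \<eta> \<and> \<eta> < 1 \<longrightarrow>
    (\<exists>D \<Phi>. finite_axial_outer_approx L \<eta> D
      \<and> continuous_on UNIV \<Phi> \<and> positively_homogeneous \<Phi>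
      \<and> L \<subseteq> D \<and> D = {x. \<Phi> x \<ge> 0}
      \<and> (\<forall>M>L\<^sub>g.
           inf_value UNIV (penalized g M \<Phi>) = inf_value D g
         \<and> (\<forall>x. is_solution UNIV (penalized g M \<Phi>) x \<longrightarrow> x \<in> D)
         \<and> (\<forall>x R. 0 < R \<and> is_solution UNIV (penalized g M \<Phi>) x \<and> norm x \<le> R \<longrightarrow>
              (\<exists>v v\<^sub>\<eta> :: real.
                 inf_value L g = ereal v
               \<and> inf_value UNIV (penalized g M \<Phi>) = ereal v\<^sub>\<eta>
               \<and> (\<exists>l\<in>L.
                    norm (x - l) \<le> \<eta> * norm x \<and> \<eta> * norm x \<le> R * \<eta>
                  \<and> 0 \<le> g l - v \<and> g l - v \<le> L\<^sub>g * \<eta> * norm x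
                  \<and> 0 \<le> v - v\<^sub>\<eta> \<and> v - v\<^sub>\<eta> \<le> L\<^sub>g * \<eta> * norm x
                  \<and> L\<^sub>g * \<eta> * norm x \<le> L\<^sub>g * R * \<eta>
                  \<and> (\<forall>\<epsilon>. 0 < \<eta> \<and> \<eta> \<le> \<epsilon> / (L\<^sub>g * R) \<longrightarrow> g l \<le> v + \<epsilon>))))))"
proof (intro allI impI, elim conjE)
  fix \<eta> :: real assume \<eta>: "0 < \<eta>" "\<eta> < 1"
  obtain D where D: "finite_axial_outer_approx L \<eta> D"
    "\<And>x. x \<in> D \<Longrightarrow> \<exists>l\<in>L. norm (x - l) \<le> \<eta> * norm x"
    using finite_axial_outer_approx_exists[OF assms(1) \<eta>(1)] by blast
  have Dc: "closed D" "cone D" "0 \<in> D" "D \<noteq> {}" "L \<subseteq> D"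
    using D(1) by (auto simp: finite_axial_outer_approx_def proper_cone_def)
  define \<Phi> where "\<Phi> = (\<lambda>x. - infdist x D)"
  have cont: "continuous_on UNIV \<Phi>" unfolding \<Phi>_def by (intro continuous_intros)
  have hom: "positively_homogeneous \<Phi>"
    using infdist_cone_scale[OF Dc(2,3)] by (simp add: \<Phi>_def positively_homogeneous_def)
  \<comment> \<open>As distances are nonnegative, \<open>\<Phi> x \<ge> 0\<close> means distance
    zero, which is membership because \<open>D\<close> is closed.\<close>
  have D_eq: "D = {x. \<Phi> x \<ge> 0}"
    using in_closed_iff_infdist_zero[OF Dc(1,4)] infdist_nonneg[of _ D]
    by (auto simp: \<Phi>_def intro: antisym)
  have inf_eq: "inf_value UNIV (penalized g M \<Phi>) = inf_value D g" if "L\<^sub>g < M" for M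
    unfolding \<Phi>_def using that by (intro inf_value_penalized_infdist[OF assms(3,2) Dc(4)]) simp
  have sol_D: "x \<in> D" if "L\<^sub>g < M" "is_solution UNIV (penalized g M \<Phi>) x" for M x
    using penalized_infdist_solution_mem[OF assms(3,2) Dc(1,4) that(1)] that(2)
    by (simp add: \<Phi>_def)
  have estimates: "\<exists>v v\<^sub>\<eta> :: real.
       inf_value L g = ereal v \<and> inf_value UNIV (penalized g M \<Phi>) = ereal v\<^sub>\<eta>
     \<and> (\<exists>l\<in>L. norm (x - l) \<le> \<eta> * norm x \<and> \<eta> * norm x \<le> R * \<eta>
          \<and> 0 \<le> g l - v \<and> g l - v \<le> L\<^sub>g * \<eta> * norm x
          \<and> 0 \<le> v - v\<^sub>\<eta> \<and> v - v\<^sub>\<eta> \<le> L\<^sub>g * \<eta> * norm x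
          \<and> L\<^sub>g * \<eta> * norm x \<le> L\<^sub>g * R * \<eta>
          \<and> (\<forall>\<epsilon>. 0 < \<eta> \<and> \<eta> \<le> \<epsilon> / (L\<^sub>g * R) \<longrightarrow> g l \<le> v + \<epsilon>))"
    if M: "L\<^sub>g < M" and R: "0 < R" "norm x \<le> R"
      and sol: "is_solution UNIV (penalized g M \<Phi>) x" for M x R
  proof -
    have xD: "x \<in> D" by (rule sol_D[OF M sol])
    then have val: "inf_value UNIV (penalized g M \<Phi>) = ereal (g x)"
      using sol by (simp add: is_solution_def \<Phi>_def penalized_infdist)
    obtain l where l: "l \<in> L" "norm (x - l) \<le> \<eta> * norm x" using D(2)[OF xD] by blast
    \<comment> \<open>By exactness \<open>g x\<close> is the infimum over \<open>D\<close>, and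
      \<open>L\<close> is a subset of \<open>D\<close>. Together with the value at \<open>l\<close>
      this encloses the infimum over \<open>L\<close> between two reals, so it is finite.\<close>
    have lower: "ereal (g x) \<le> inf_value L g"
      using val inf_eq[OF M] Dc(5) unfolding inf_value_def by (metis INF_superset_mono order_refl)
    have upper: "inf_value L g \<le> ereal (g l)"
      unfolding inf_value_def using l(1) by (rule INF_lower)
    obtain v where v: "inf_value L g = ereal v"
      using lower upper by (cases "inf_value L g") auto
    have "g l - g x \<le> L\<^sub>g * norm (x - l)"
      using lipschitz_onD[OF assms(3), of x l] by (simp add: dist_real_def dist_norm)
    also have "\<dots> \<le> L\<^sub>g * \<eta> * norm x"
      using l(2) assms(2) by (simp add: mult.assoc)
    finally have gl: "g l - g x \<le> L\<^sub>g * \<eta> * norm x" .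
    \<comment> \<open>Since \<open>g x\<close> is the optimal penalized value, \<open>v\<close> lies
      between it and \<open>g l\<close>; the bound \<open>gl\<close> on the whole interval therefore
      controls both errors.\<close>
    have bounds: "g x \<le> v" "v \<le> g l" using lower upper v by auto
    have \<eta>R: "\<eta> * norm x \<le> R * \<eta>" using R \<eta> by simp
    then have LR: "L\<^sub>g * \<eta> * norm x \<le> L\<^sub>g * R * \<eta>" using assms(2) by (simp add: mult.assoc)
    have "g l \<le> v + \<epsilon>" if "\<eta> \<le> \<epsilon> / (L\<^sub>g * R)" for \<epsilon>
    proof -
      have "L\<^sub>g * R * \<eta> \<le> \<epsilon>" using that assms(2) R by (simp add: field_simps)
      then show ?thesis using gl bounds LR by linarith
    qed
    then show ?thesis
      using l gl bounds \<eta>R LR v val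
      by (intro exI[of _ v] exI[of _ "g x"] conjI bexI[of _ l]) auto
  qed
  show "\<exists>D \<Phi>. finite_axial_outer_approx L \<eta> D
      \<and> continuous_on UNIV \<Phi> \<and> positively_homogeneous \<Phi>
      \<and> L \<subseteq> D \<and> D = {x. \<Phi> x \<ge> 0}
      \<and> (\<forall>M>L\<^sub>g.
           inf_value UNIV (penalized g M \<Phi>) = inf_value D g
         \<and> (\<forall>x. is_solution UNIV (penalized g M \<Phi>) x \<longrightarrow> x \<in> D)
         \<and> (\<forall>x R. 0 < R \<and> is_solution UNIV (penalized g M \<Phi>) x \<and> norm x \<le> R \<longrightarrow>
              (\<exists>v v\<^sub>\<eta> :: real.
                 inf_value L g = ereal v
               \<and> inf_value UNIV (penalized g M \<Phi>) = ereal v\<^sub>\<eta>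
               \<and> (\<exists>l\<in>L.
                    norm (x - l) \<le> \<eta> * norm x \<and> \<eta> * norm x \<le> R * \<eta>
                  \<and> 0 \<le> g l - v \<and> g l - v \<le> L\<^sub>g * \<eta> * norm x
                  \<and> 0 \<le> v - v\<^sub>\<eta> \<and> v - v\<^sub>\<eta> \<le> L\<^sub>g * \<eta> * norm x
                  \<and> L\<^sub>g * \<eta> * norm x \<le> L\<^sub>g * R * \<eta>
                  \<and> (\<forall>\<epsilon>. 0 < \<eta> \<and> \<eta> \<le> \<epsilon> / (L\<^sub>g * R) \<longrightarrow> g l \<le> v + \<epsilon>)))))"
    by (intro exI[of _ D] exI[of _ \<Phi>] conjI allI impI; (elim conjE)?)
      (fact D(1) cont hom Dc(5) D_eq | rule inf_eq sol_D estimates; assumption)+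
qed

end
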